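(* Let $m\in\mathbb{N}$. The dyadic and the classical definitions of the Riemann integral are equivalent, in the following sense. (a) Let $f\in RI(\mathbb{R}^{m})$, let $A$ be any closed $m$-rectangle such that $f$ vanishes on $\mathbb{R}^{m}\setminus A$, and let $\phi$ be the restriction of $f$ to $A$. Then $\phi$ is classically Riemann integrable on $A$, and its classical Riemann integral over $A$ equals $\int_{\mathbb{R}^{m}}f$. (b) Conversely, let $A$ be a closed $m$-rectangle and let $\phi:A\to\mathbb{R}$ be classically Riemann integrable on $A$. Define $f:\mathbb{R}^{m}\to\mathbb{R}$ to equal $\phi$ on $A$ and $0$ on $\mathbb{R}^{m}\setminus A$. Then $f\in RI(\mathbb{R}^{m})$, and $\int_{\mathbb{R}^{m}}f$ equals the classical Riemann integral of $\phi$ over $A$.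
   Context: Dyadic definition. For $m\in\mathbb{N}=\{1,2,\dots\}$ and an integer $k\ge 0$, $D_{k}(\mathbb{R}^{m})$ is the collection of all semiclosed dyadic cubes $\prod_{j=1}^{m}[n_{j}2^{-k},(n_{j}+1)2^{-k})$ with $n_{1},\dots,n_{m}\in\mathbb{Z}$. $BB(\mathbb{R}^{m})$ is the set of bounded functions $f:\mathbb{R}^{m}\to\mathbb{R}$ which vanish outside some bounded set. For $f\in BB(\mathbb{R}^{m})$ set $U_{k}(f)=2^{-km}\sum_{I\in D_{k}(\mathbb{R}^{m})}\sup_{p\in I}f(p)$ and $L_{k}(f)=2^{-km}\sum_{I\in D_{k}(\mathbb{R}^{m})}\inf_{p\in I}f(p)$ (only finitely many terms are non-zero). The sequences $U_k(f)$ and $L_k(f)$ are bounded and, respectively, non-increasing and non-decreasing in $k$, so they converge. A function $f\in BB(\mathbb{R}^{m})$ is in $RI(\mathbb{R}^{m})$ if $\lim_{k\to\infty}U_{k}(f)=\lim_{k\to\infty}L_{k}(f)$; the common value is denoted $\int_{\mathbb{R}^{m}}f$. Classical definition (Spivak). A closed $m$-rectangle is a set $A=\prod_{j=1}^{m}[a_{j},b_{j}]$ with $a_j\le b_j$. A partition $P$ of $A$ is given by choosing, for each $j$, finitely many points $a_{j}=t_{j,0}\le t_{j,1}\le\dots\le t_{j,N_{j}}=b_{j}$; its subrectangles are the closed $m$-rectangles $S=\prod_{j=1}^{m}[t_{j,i_{j}-1},t_{j,i_{j}}]$ with $1\le i_{j}\le N_{j}$, and we write $S\in P$. The volume $v(S)$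 is the product of the side lengths. For a bounded function $\phi:A\to\mathbb{R}$ put $U(\phi,P)=\sum_{S\in P}\sup_{q\in S}\phi(q)\,v(S)$ and $L(\phi,P)=\sum_{S\in P}\inf_{q\in S}\phi(q)\,v(S)$. The function $\phi$ is classically Riemann integrable on $A$ if it is bounded and $\sup_{P}L(\phi,P)=\inf_{P}U(\phi,P)$, where $P$ ranges over all partitions of $A$; the common value is the classical Riemann integral of $\phi$ over $A$. *)

theory Defs
  imports "HOL-Analysis.Analysis"
begin

text \<open>
  The space of dimension \<open>m\<close> is \<^typ>\<open>real ^ 'm\<close> for an arbitrary finite index type
  \<open>'m\<close>; types being nonempty, \<open>m = CARD('m)\<close> ranges over the positive integers.
\<close>

subsection \<open>The dyadic Riemann integral\<close>

definition dyadic_cube :: "nat \<Rightarrow> int ^ 'm \<Rightarrow> (real ^ 'm) set" where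
  "dyadic_cube k n =
     {x. \<forall>j. of_int (n $ j) / 2 ^ k \<le> x $ j \<and> x $ j < (of_int (n $ j) + 1) / 2 ^ k}"

definition dyadic_cubes :: "nat \<Rightarrow> (real ^ 'm) set set" where
  "dyadic_cubes k = range (dyadic_cube k)"

definition BB :: "(real ^ 'm \<Rightarrow> real) set" where
  "BB = {f. bounded (range f) \<and> (\<exists>B. bounded B \<and> (\<forall>x. x \<notin> B \<longrightarrow> f x = 0))}"

text \<open>
  For \<open>f \<in> BB\<close> the infinite sums below have only finitely many non-zero terms, so
  they are the finite sums of these terms.
\<close>

definition dyadic_upper :: "nat \<Rightarrow> (real ^ 'm \<Rightarrow> real) \<Rightarrow> real" where
  "dyadic_upper k f =
     1 / 2 ^ (k * CARD('m)) * (\<Sum>\<^sub>\<infinity>I\<in>dyadic_cubes k. SUP p\<in>I. f p)"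

definition dyadic_lower :: "nat \<Rightarrow> (real ^ 'm \<Rightarrow> real) \<Rightarrow> real" where
  "dyadic_lower k f =
     1 / 2 ^ (k * CARD('m)) * (\<Sum>\<^sub>\<infinity>I\<in>dyadic_cubes k. INF p\<in>I. f p)"

definition RI :: "(real ^ 'm \<Rightarrow> real) set" where
  "RI = {f \<in> BB. \<exists>c. (\<lambda>k. dyadic_upper k f) \<longlonglongrightarrow> c \<and> (\<lambda>k. dyadic_lower k f) \<longlonglongrightarrow> c}"

definition dyadic_integral :: "(real ^ 'm \<Rightarrow> real) \<Rightarrow> real" where
  "dyadic_integral f = lim (\<lambda>k. dyadic_upper k f)"

subsection \<open>The classical Riemann integral\<close>

text \<open>
  A closed rectangle is \<open>cbox a b\<close> with \<open>a $ j \<le> b $ j\<close> for all \<open>j\<close>; degenerate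
  rectangles are allowed. A partition is a pair \<open>(N, t)\<close> whose points in direction
  \<open>j\<close> are \<open>t j 0, \<dots>, t j (N j)\<close>; the values \<open>t j i\<close> for \<open>i > N j\<close> are irrelevant.
\<close>

type_synonym 'm partition = "('m \<Rightarrow> nat) \<times> ('m \<Rightarrow> nat \<Rightarrow> real)"

definition partitions :: "real ^ 'm \<Rightarrow> real ^ 'm \<Rightarrow> 'm partition set" where
  "partitions a b =
     {(N, t). \<forall>j. 1 \<le> N j \<and> t j 0 = a $ j \<and> t j (N j) = b $ j \<and>
                  (\<forall>i < N j. t j i \<le> t j (Suc i))}"

text \<open>
  Subrectangles are indexed by multi-indices rather than collected as sets, since
  points of a partition may coincide.
\<close>

definition subrect_indices :: "'m partition \<Rightarrow> ('m \<Rightarrow> nat) set" where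
  "subrect_indices P = {i. \<forall>j. 1 \<le> i j \<and> i j \<le> fst P j}"

definition subrect :: "('m::finite) partition \<Rightarrow> ('m \<Rightarrow> nat) \<Rightarrow> (real ^ 'm) set" where
  "subrect P i = cbox (\<chi> j. snd P j (i j - 1)) (\<chi> j. snd P j (i j))"

definition subrect_volume :: "('m::finite) partition \<Rightarrow> ('m \<Rightarrow> nat) \<Rightarrow> real" where
  "subrect_volume P i = (\<Prod>j\<in>UNIV. snd P j (i j) - snd P j (i j - 1))"

definition upper_sum :: "(real ^ 'm \<Rightarrow> real) \<Rightarrow> ('m::finite) partition \<Rightarrow> real" where
  "upper_sum \<phi> P = (\<Sum>i\<in>subrect_indices P. (SUP q\<in>subrect P i. \<phi> q) * subrect_volume P i)"

definition lower_sum :: "(real ^ 'm \<Rightarrow> real) \<Rightarrow> ('m::finite) partition \<Rightarrow> real" where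
  "lower_sum \<phi> P = (\<Sum>i\<in>subrect_indices P. (INF q\<in>subrect P i. \<phi> q) * subrect_volume P i)"

text \<open>
  Functions on \<open>cbox a b\<close> are represented by total functions; only their values on
  \<open>cbox a b\<close> enter the following definitions.
\<close>

definition classically_integrable ::
    "real ^ 'm \<Rightarrow> real ^ 'm \<Rightarrow> (real ^ 'm \<Rightarrow> real) \<Rightarrow> bool" where
  "classically_integrable a b \<phi> \<longleftrightarrow>
     bounded (\<phi> ` cbox a b) \<and>
     (SUP P\<in>partitions a b. lower_sum \<phi> P) = (INF P\<in>partitions a b. upper_sum \<phi> P)"

definition classical_integral ::
    "real ^ 'm \<Rightarrow> real ^ 'm \<Rightarrow> (real ^ 'm \<Rightarrow> real) \<Rightarrow> real" where
  "classical_integral a b \<phi> = (SUP P\<in>partitions a b. lower_sum \<phi> P)"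

end

theory Submission
  imports Defs
begin

text \<open>
  Both upper integrals are the Lebesgue integral of one function, the upper envelope
  \<open>f* x = inf {sup (f ` ball x e) | e > 0}\<close>, where \<open>f\<close> is extended by \<open>0\<close> outside the
  rectangle. Comparing both kinds of sums with \<open>f*\<close> takes the place of a common refinement of
  the dyadic grid and a partition.

  Dyadic cubes and subrectangles of a partition are both treated as tiles: sets with disjoint
  interiors that cover almost every point at which \<open>f*\<close> is non-zero. An upper sum is the
  integral of the step function whose value inside a tile is the supremum of \<open>f\<close> over that
  tile. A tile with \<open>x\<close> in its interior contains a ball around \<open>x\<close>, so the step function
  dominates \<open>f*\<close> almost everywhere, and every upper sum is at least \<open>\<integral>f*\<close>
  (\<open>integral_upper_envelope_le_tile_sum\<close>). If the diameters of the tiles tend to \<open>0\<close>, the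
  step functions converge to \<open>f*\<close> off the countably many hyperplanes carrying the
  boundaries of tiles, and dominated convergence gives the limit \<open>\<integral>f*\<close> for the sums
  (\<open>tile_sum_tendsto\<close>). Hence the dyadic upper sums tend to \<open>\<integral>f*\<close>
  (\<open>dyadic_upper_tendsto\<close>). The upper sums over all partitions have infimum \<open>\<integral>f*\<close>, since
  those of the uniform partitions tend to it (\<open>INF_upper_sum\<close>).

  Lower sums of \<open>f\<close> are the negatives of upper sums of \<open>-f\<close>, so the lower integrals agree
  as well. Either notion of integrability therefore says that these two numbers, the upper
  and the lower integral, are equal, and their common value is either integral.
\<close>

section \<open>The upper envelope of a bounded function\<close>

definition upper_envelope :: "('a::metric_space \<Rightarrow> real) \<Rightarrow> 'a \<Rightarrow> real" where
  "upper_envelope f x = (INF e\<in>{0<..}. SUP y\<in>ball x e. f y)"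

lemma bounded_range_bdd:
  fixes f :: "'a \<Rightarrow> real"
  assumes "bounded (range f)"
  shows "bdd_above (f ` S)" "bdd_below (f ` S)"
  using bounded_subset[OF assms, of "f ` S"]
  by (auto intro!: bounded_imp_bdd_above bounded_imp_bdd_below)

lemma abs_SUP_le:
  fixes f :: "'a \<Rightarrow> real"
  assumes "\<And>x. \<bar>f x\<bar> \<le> M" "S \<noteq> {}"
  shows "\<bar>SUP x\<in>S. f x\<bar> \<le> M"
proof -
  have b: "bdd_above (f ` S)" 
    by (rule bdd_aboveI[of _ M]) (use assms(1) in \<open>auto simp: abs_le_iff\<close>)
  obtain x where x: "x \<in> S" using assms(2) by blast
  have "-M \<le> f x" using assms(1)[of x] by linarith
  also have "f x \<le> (SUP x\<in>S. f x)" using b x by (rule cSUP_upper2) simp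
  finally have "- M \<le> (SUP x\<in>S. f x)" .
  moreover have "(SUP x\<in>S. f x) \<le> M"
    by (rule cSUP_least) (use assms in \<open>auto simp: abs_le_iff\<close>)
  ultimately show ?thesis by (simp add: abs_le_iff)
qed

lemma bdd_below_SUP_ball:
  fixes f :: "'a::metric_space \<Rightarrow> real"
  assumes "bounded (range f)"
  shows "bdd_below ((\<lambda>e. SUP y\<in>ball x e. f y) ` {0<..})"
proof -
  obtain M where M: "\<And>x. \<bar>f x\<bar> \<le> M" using assms by (auto simp: bounded_iff)
  have "- M \<le> (SUP y\<in>ball x e. f y)" if "e > 0" for e
    using abs_SUP_le[of f M "ball x e", OF M] that by (simp add: abs_le_iff)
  then show ?thesis by (intro bdd_belowI2[of _ "-M"]) auto
qed

lemma upper_envelope_le_SUP_ball: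
  assumes "bounded (range f)" "e > 0"
  shows "upper_envelope f x \<le> (SUP y\<in>ball x e. f y)"
  unfolding upper_envelope_def
  by (rule cINF_lower[OF bdd_below_SUP_ball[OF assms(1)]]) (use assms in auto)

lemma upper_envelope_le_SUP:
  assumes f: "bounded (range f)" and x: "x \<in> interior S"
  shows "upper_envelope f x \<le> (SUP y\<in>S. f y)"
proof -
  obtain e where e: "e > 0" "ball x e \<subseteq> S"
    using x by (auto simp: mem_interior)
  note upper_envelope_le_SUP_ball[OF f e(1), of x]
  also have "(SUP y\<in>ball x e. f y) \<le> (SUP y\<in>S. f y)"
    by (rule cSUP_subset_mono) (use e bounded_range_bdd[OF f] in auto)
  finally show ?thesis .
qed

lemma upper_envelope_less_iff:
  assumes f: "bounded (range f)"
  shows "upper_envelope f x < c \<longleftrightarrow> (\<exists>e>0. (SUP y\<in>ball x e. f y) < c)"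
proof
  assume "upper_envelope f x < c"
  then show "\<exists>e>0. (SUP y\<in>ball x e. f y) < c"
    unfolding upper_envelope_def
    by (subst (asm) cINF_less_iff) (use bdd_below_SUP_ball[OF f] in auto)
next
  assume "\<exists>e>0. (SUP y\<in>ball x e. f y) < c"
  then show "upper_envelope f x < c"
    using upper_envelope_le_SUP_ball[OF f] by (meson le_less_trans)
qed

text \<open>
  The envelope is upper semicontinuous: a ball on which the supremum of \<open>f\<close> is below \<open>c\<close>
  bounds the envelope at each of its points. Hence it is Borel even though \<open>f\<close> need not be.
\<close>
lemma borel_measurable_upper_envelope:
  assumes f: "bounded (range f)"
  shows "upper_envelope f \<in> borel_measurable borel"
proof -
  have "open {x. upper_envelope f x < c}" for c
    unfolding open_contains_ball
  proof safe
    fix x assume "upper_envelope f x < c"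
    then obtain e where e: "e > 0" "(SUP y\<in>ball x e. f y) < c"
      using upper_envelope_less_iff[OF f] by blast
    have "upper_envelope f y < c" if "y \<in> ball x e" for y
      using upper_envelope_le_SUP[OF f, of y "ball x e"] that e(2) by (simp add: interior_open)
    then show "\<exists>e>0. ball x e \<subseteq> {x. upper_envelope f x < c}"
      using e(1) by blast
  qed
  then show ?thesis
    by (intro borel_measurableI_less) simp
qed

lemma abs_upper_envelope_le:
  assumes M: "\<And>x. \<bar>f x\<bar> \<le> M"
  shows "\<bar>upper_envelope f x\<bar> \<le> M"
proof -
  have f: "bounded (range f)" using M by (auto simp: bounded_iff)
  have "upper_envelope f x \<le> M"
    using upper_envelope_le_SUP_ball[OF f, of 1 x] abs_SUP_le[of f M "ball x 1", OF M] by auto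
  moreover have "- M \<le> upper_envelope f x"
    unfolding upper_envelope_def
  proof (rule cINF_greatest)
    fix e :: real assume "e \<in> {0<..}"
    then show "- M \<le> (SUP y\<in>ball x e. f y)"
      using abs_SUP_le[of f M "ball x e", OF M] by (simp add: abs_le_iff)
  qed auto
  ultimately show ?thesis by linarith
qed

lemma upper_envelope_eq_0:
  assumes f: "bounded (range f)" and S: "x \<in> interior S" "\<And>y. y \<in> S \<Longrightarrow> f y = 0"
  shows "upper_envelope f x = 0"
proof -
  have "upper_envelope f x \<le> (SUP y\<in>S. f y)"
    by (rule upper_envelope_le_SUP[OF f S(1)])
  also have "\<dots> = (SUP y\<in>S. 0)" using S(2) by simp
  also have "\<dots> = 0" using S(1) interior_subset by (subst cSUP_const) auto
  finally have 1: "upper_envelope f x \<le> 0" .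
  have "0 \<le> upper_envelope f x"
    unfolding upper_envelope_def
  proof (rule cINF_greatest)
    fix e :: real assume "e \<in> {0<..}"
    then have "f x \<le> (SUP y\<in>ball x e. f y)"
      by (intro cSUP_upper bounded_range_bdd f) auto
    then show "0 \<le> (SUP y\<in>ball x e. f y)" using S interior_subset by (metis subsetD)
  qed auto
  with 1 show ?thesis by simp
qed

lemma upper_envelope_eq_0_outside:
  assumes f: "bounded (range f)" and A: "closed A" "\<And>y. y \<notin> A \<Longrightarrow> f y = 0" and x: "x \<notin> A"
  shows "upper_envelope f x = 0"
proof (rule upper_envelope_eq_0[OF f])
  show "x \<in> interior (- A)" using A(1) x by (simp add: interior_open open_Compl)
qed (use A(2) in simp)

text \<open>
  Having \<open>x\<close> in the interior bounds the suprema from below by the envelope, and shrinking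
  into balls around \<open>x\<close> bounds them from above.
\<close>
lemma SUP_tendsto_upper_envelope:
  fixes S :: "nat \<Rightarrow> 'a::metric_space set"
  assumes f: "bounded (range f)" and S: "\<And>k. x \<in> interior (S k)"
    and \<delta>: "\<delta> \<longlonglongrightarrow> 0" "\<And>k y. y \<in> S k \<Longrightarrow> dist x y \<le> \<delta> k"
  shows "(\<lambda>k. SUP y\<in>S k. f y) \<longlonglongrightarrow> upper_envelope f x"
proof (rule order_tendstoI)
  fix c assume "c < upper_envelope f x"
  then show "\<forall>\<^sub>F k in sequentially. c < (SUP y\<in>S k. f y)"
    using upper_envelope_le_SUP[OF f S] by (intro always_eventually allI) (rule less_le_trans)
next
  fix c assume "upper_envelope f x < c"
  then obtain e where e: "e > 0" "(SUP y\<in>ball x e. f y) < c"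
    using upper_envelope_less_iff[OF f] by blast
  have "\<forall>\<^sub>F k in sequentially. \<delta> k < e"
    using \<delta>(1) e(1) by (rule order_tendstoD)
  then show "\<forall>\<^sub>F k in sequentially. (SUP y\<in>S k. f y) < c"
  proof eventually_elim
    case (elim k)
    have "S k \<subseteq> ball x e" using \<delta>(2)[of _ k] elim by fastforce
    moreover have "S k \<noteq> {}" using S[of k] interior_subset by blast
    ultimately have "(SUP y\<in>S k. f y) \<le> (SUP y\<in>ball x e. f y)"
      using bounded_range_bdd[OF f] by (intro cSUP_subset_mono) auto
    then show ?case using e(2) by simp
  qed
qed

section \<open>Upper sums as integrals of step functions\<close>

text \<open>
  Tiles are indexed, so that degenerate or repeated tiles are harmless, and only their
  interiors are required to be disjoint. Points off the tiles are allowed where the envelope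
  vanishes, because dyadic cubes that miss the support and points outside the rectangle
  contribute nothing.
\<close>
definition tiling ::
  "(real ^ 'm \<Rightarrow> real) \<Rightarrow> 'i set \<Rightarrow> ('i \<Rightarrow> (real ^ 'm) set) \<Rightarrow> bool" where
  "tiling f I S \<longleftrightarrow> finite I \<and> (\<forall>i\<in>I. interior (S i) \<in> lmeasurable) \<and>
     disjoint_family_on (\<lambda>i. interior (S i)) I \<and>
     (AE x in lborel. x \<notin> (\<Union>i\<in>I. interior (S i)) \<longrightarrow> upper_envelope f x = 0)"

definition tile_sum :: "(real ^ 'm \<Rightarrow> real) \<Rightarrow> 'i set \<Rightarrow> ('i \<Rightarrow> (real ^ 'm) set) \<Rightarrow> real" where
  "tile_sum f I S = (\<Sum>i\<in>I. (SUP y\<in>S i. f y) * measure lborel (interior (S i)))"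

definition tile_step ::
  "(real ^ 'm \<Rightarrow> real) \<Rightarrow> 'i set \<Rightarrow> ('i \<Rightarrow> (real ^ 'm) set) \<Rightarrow> real ^ 'm \<Rightarrow> real" where
  "tile_step f I S x = (\<Sum>i\<in>I. (SUP y\<in>S i. f y) * indicator (interior (S i)) x)"

lemma tile_step_eq:
  assumes "tiling f I S" "i \<in> I" "x \<in> interior (S i)"
  shows "tile_step f I S x = (SUP y\<in>S i. f y)"
proof -
  have "x \<notin> interior (S j)" if "j \<in> I" "j \<noteq> i" for j
    using assms that unfolding tiling_def disjoint_family_on_def by blast
  then have "tile_step f I S x = (\<Sum>j\<in>I. if j = i then (SUP y\<in>S i. f y) else 0)"
    unfolding tile_step_def using assms(3) by (intro sum.cong) auto
  then show ?thesis using assms by (simp add: tiling_def)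
qed

lemma tile_step_eq_0: "x \<notin> (\<Union>i\<in>I. interior (S i)) \<Longrightarrow> tile_step f I S x = 0"
  unfolding tile_step_def by (intro sum.neutral) auto

lemma has_bochner_integral_tile_step:
  assumes "tiling f I S"
  shows "has_bochner_integral lborel (tile_step f I S) (tile_sum f I S)"
  unfolding tile_step_def tile_sum_def
proof (intro has_bochner_integral_sum has_bochner_integral_mult_right)
  fix i assume "i \<in> I"
  then have "interior (S i) \<in> lmeasurable" using assms by (simp add: tiling_def)
  then have "emeasure lborel (interior (S i)) < \<infinity>"
    by (auto simp: fmeasurable_def)
  then show "has_bochner_integral lborel (indicator (interior (S i))) (measure lborel (interior (S i)))"
    by (intro has_bochner_integral_real_indicator) auto
qed

lemma integrable_upper_envelope:
  fixes f :: "real ^ 'm \<Rightarrow> real"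
  assumes f: "bounded (range f)" and 0: "\<And>x. x \<notin> cbox a b \<Longrightarrow> f x = 0"
  shows "integrable lborel (upper_envelope f)"
proof -
  obtain M where M: "\<And>x. \<bar>f x\<bar> \<le> M" using f by (auto simp: bounded_iff)
  note z = upper_envelope_eq_0_outside[OF f closed_cbox 0]
  have i: "integrable lborel (\<lambda>x. M * indicator (cbox a b) x)" 
    by (intro integrable_mult_right integrable_real_indicator emeasure_lborel_cbox_finite) simp
  show ?thesis
  proof (rule Bochner_Integration.integrable_bound[OF i])
    show "upper_envelope f \<in> borel_measurable lborel"
      using borel_measurable_upper_envelope[OF f] by simp
    show "AE x in lborel. norm (upper_envelope f x) \<le> norm (M * indicator (cbox a b) x)"
      using abs_upper_envelope_le[of f M, OF M] z
      by (intro AE_I2) (auto simp: indicator_def abs_le_iff intro: order_trans[OF _ abs_ge_self])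
  qed
qed

text \<open>
  In the interior of a tile the step function is the supremum of \<open>f\<close> over a neighbourhood of
  the point; elsewhere both functions vanish almost everywhere.
\<close>
lemma integral_upper_envelope_le_tile_sum:
  fixes f :: "real ^ 'm \<Rightarrow> real"
  assumes f: "bounded (range f)" and 0: "\<And>x. x \<notin> cbox a b \<Longrightarrow> f x = 0"
    and T: "tiling f I S"
  shows "(\<integral>x. upper_envelope f x \<partial>lborel) \<le> tile_sum f I S"
proof -
  note h = has_bochner_integral_tile_step[OF T]
  have "(\<integral>x. upper_envelope f x \<partial>lborel) \<le> (\<integral>x. tile_step f I S x \<partial>lborel)"
  proof (rule integral_mono_AE)
    show "integrable lborel (upper_envelope f)"
      using f 0 by (rule integrable_upper_envelope)
    show "integrable lborel (tile_step f I S)"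
      using h by (simp add: has_bochner_integral_iff)
    have "AE x in lborel. x \<notin> (\<Union>i\<in>I. interior (S i)) \<longrightarrow> upper_envelope f x = 0"
      using T by (simp add: tiling_def)
    then show "AE x in lborel. upper_envelope f x \<le> tile_step f I S x"
    proof eventually_elim
      case (elim x)
      show ?case
      proof (cases "x \<in> (\<Union>i\<in>I. interior (S i))")
        case True
        then obtain i where "i \<in> I" "x \<in> interior (S i)" by blast
        then show ?thesis
          using upper_envelope_le_SUP[OF f] by (simp add: tile_step_eq[OF T])
      next
        case False
        then show ?thesis using elim tile_step_eq_0[OF False] by simp
      qed
    qed
  qed
  also have "\<dots> = tile_sum f I S" using h by (simp add: has_bochner_integral_iff)
  finally show ?thesis .
qed

text \<open>
  Dominated convergence: the step functions are bounded by a multiple of the indicator of one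
  fixed box, and off a null set they converge because the tiles around a point shrink to it.
\<close>
lemma tile_sum_tendsto:
  fixes f :: "real ^ 'm \<Rightarrow> real" and I :: "nat \<Rightarrow> 'i set"
  assumes f: "bounded (range f)" and 0: "\<And>x. x \<notin> cbox a b \<Longrightarrow> f x = 0"
    and T: "\<And>k. tiling f (I k) (S k)"
    and C: "\<And>k i. i \<in> I k \<Longrightarrow> S k i \<subseteq> cbox c d"
    and \<delta>: "\<delta> \<longlonglongrightarrow> 0" 
      "\<And>k i x y. i \<in> I k \<Longrightarrow> x \<in> S k i \<Longrightarrow> y \<in> S k i \<Longrightarrow> dist x y \<le> \<delta> k"
  shows "(\<lambda>k. tile_sum f (I k) (S k)) \<longlonglongrightarrow> (\<integral>x. upper_envelope f x \<partial>lborel)"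
proof -
  obtain M where M: "\<And>x. \<bar>f x\<bar> \<le> M" using f by (auto simp: bounded_iff)
  have M0: "M \<ge> 0" using M[of undefined] by linarith
  note h = has_bochner_integral_tile_step[OF T]
  have "(\<lambda>k. \<integral>x. tile_step f (I k) (S k) x \<partial>lborel) \<longlonglongrightarrow> (\<integral>x. upper_envelope f x \<partial>lborel)"
  proof (rule integral_dominated_convergence)
    show "upper_envelope f \<in> borel_measurable lborel"
      using borel_measurable_upper_envelope[OF f] by simp
    show "tile_step f (I k) (S k) \<in> borel_measurable lborel" for k
      using h[of k] by (auto simp: has_bochner_integral_iff dest: borel_measurable_integrable)
    show "integrable lborel (\<lambda>x. M * indicator (cbox c d) x)" 
      by (intro integrable_mult_right integrable_real_indicator emeasure_lborel_cbox_finite) simp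
    show "AE x in lborel. norm (tile_step f (I k) (S k) x) \<le> M * indicator (cbox c d) x" for k
    proof (rule AE_I2)
      fix x
      show "norm (tile_step f (I k) (S k) x) \<le> M * indicator (cbox c d) x"
      proof (cases "x \<in> (\<Union>i\<in>I k. interior (S k i))")
        case True
        then obtain i where i: "i \<in> I k" "x \<in> interior (S k i)" by blast
        then have "x \<in> S k i" using interior_subset by blast
        with i C[of i k] have "x \<in> cbox c d" "S k i \<noteq> {}" by auto
        then show ?thesis
          using tile_step_eq[OF T i] abs_SUP_le[of f M, OF M] by simp
      next
        case False
        then show ?thesis using tile_step_eq_0[OF False] M0 by simp
      qed
    qed
    have "AE x in lborel. \<forall>k. x \<notin> (\<Union>i\<in>I k. interior (S k i)) \<longrightarrow> upper_envelope f x = 0"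
      using T by (subst AE_all_countable) (simp add: tiling_def)
    then show "AE x in lborel. (\<lambda>k. tile_step f (I k) (S k) x) \<longlonglongrightarrow> upper_envelope f x"
    proof eventually_elim
      case (elim x)
      \<comment> \<open>The point may lie in a tile for some \<open>k\<close> only. Balls of radius \<open>1 / Suc k\<close> replace
        the missing tiles, which yields a single sequence of sets shrinking to \<open>x\<close>. A missing
        tile forces the limit to be \<open>0\<close>, the value of the step function there.\<close>
      have "\<exists>A. (\<exists>i\<in>I k. x \<in> interior (S k i) \<and> A = S k i) \<or>
          x \<notin> (\<Union>i\<in>I k. interior (S k i)) \<and> A = ball x (1 / Suc k)" for k
        by blast
      then obtain S' where S': "(\<exists>i\<in>I k. x \<in> interior (S k i) \<and> S' k = S k i) \<or>
          x \<notin> (\<Union>i\<in>I k. interior (S k i)) \<and> S' k = ball x (1 / Suc k)" for k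
        by metis
      have lim: "(\<lambda>k. SUP y\<in>S' k. f y) \<longlonglongrightarrow> upper_envelope f x"
      proof (rule SUP_tendsto_upper_envelope[OF f])
        show "x \<in> interior (S' k)" for k
          using S'[of k] by (auto simp: interior_open)
        show "(\<lambda>k. \<bar>\<delta> k\<bar> + 1 / Suc k) \<longlonglongrightarrow> 0"
          using tendsto_add[OF tendsto_rabs_zero[OF \<delta>(1)] lim_1_over_n[THEN LIMSEQ_Suc]] by simp
        show "dist x y \<le> \<bar>\<delta> k\<bar> + 1 / Suc k" if "y \<in> S' k" for k y
          using S'[of k]
        proof (elim disjE bexE conjE)
          fix i assume i: "i \<in> I k" "x \<in> interior (S k i)" "S' k = S k i"
          then have "dist x y \<le> \<delta> k" using that interior_subset by (intro \<delta>(2)) auto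
          moreover have "0 \<le> 1 / real (Suc k)" by simp
          ultimately show ?thesis by linarith
        qed (use that in \<open>auto simp: less_imp_le add_increasing\<close>)
      qed
      show ?case
      proof (cases "upper_envelope f x = 0")
        case True
        have "\<bar>tile_step f (I k) (S k) x\<bar> \<le> \<bar>SUP y\<in>S' k. f y\<bar>" for k
          using S'[of k]
        proof (elim disjE bexE conjE)
          fix i assume "i \<in> I k" "x \<in> interior (S k i)" "S' k = S k i"
          then show ?thesis by (simp add: tile_step_eq[OF T])
        next
          assume "x \<notin> (\<Union>i\<in>I k. interior (S k i))"
          then show ?thesis by (subst tile_step_eq_0) auto
        qed
        then have "\<forall>\<^sub>F k in sequentially. norm (tile_step f (I k) (S k) x) \<le> \<bar>SUP y\<in>S' k. f y\<bar>"
          by (intro always_eventually allI) (simp only: real_norm_def)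
        moreover have "(\<lambda>k. \<bar>SUP y\<in>S' k. f y\<bar>) \<longlonglongrightarrow> 0"
          using lim unfolding True by (rule tendsto_rabs_zero)
        ultimately show ?thesis unfolding True by (rule Lim_null_comparison)
      next
        case False
        then have "\<exists>i\<in>I k. x \<in> interior (S k i) \<and> S' k = S k i" for k
          using S'[of k] elim by blast
        then have "tile_step f (I k) (S k) x = (SUP y\<in>S' k. f y)" for k
          using tile_step_eq[OF T] by metis
        then show ?thesis using lim by simp
      qed
    qed
  qed
  then show ?thesis using h by (simp add: has_bochner_integral_iff)
qed

section \<open>Coordinate hyperplanes and boxes\<close>

lemma AE_lborel_nth_noteq: "AE x in lborel. (x :: real ^ 'm) $ j \<noteq> c"
proof -
  let ?H = "{x :: real ^ 'm. x \<bullet> axis j 1 = c}"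
  have "negligible ?H"
    by (rule negligible_standard_hyperplane) simp
  moreover have "?H \<in> sets lborel"
    using closed_hyperplane[of "axis j 1 :: real ^ 'm" c] by (simp add: inner_commute)
  ultimately have "?H \<in> null_sets lborel"
    by (simp add: negligible_iff_null_sets null_sets_completion_iff)
  then show ?thesis
    by (rule AE_I') (auto simp: cart_eq_inner_axis)
qed

text \<open>
  For the dyadic grid the index \<open>i\<close> is an integer, for a partition a natural number.
\<close>
lemma AE_lborel_avoid_hyperplanes:
  fixes c :: "'m::finite \<Rightarrow> 'c::countable \<Rightarrow> real"
  shows "AE x in lborel. \<forall>j i. (x :: real ^ 'm) $ j \<noteq> c j i"
  by (simp add: AE_all_countable AE_lborel_nth_noteq)

lemma dist_le_sum_vec:
  fixes x y :: "real ^ 'm"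
  assumes "\<And>j. \<bar>x $ j - y $ j\<bar> \<le> d j"
  shows "dist x y \<le> (\<Sum>j\<in>UNIV. d j)"
proof -
  have "dist x y \<le> (\<Sum>j\<in>UNIV. dist (x $ j) (y $ j))"
    unfolding dist_vec_def by (rule L2_set_le_sum) simp
  also have "\<dots> \<le> (\<Sum>j\<in>UNIV. d j)"
    using assms by (intro sum_mono) (simp add: dist_real_def)
  finally show ?thesis .
qed

lemma interior_between_boxes:
  fixes l r :: "real ^ 'm"
  assumes "box l r \<subseteq> S" "S \<subseteq> cbox l r"
  shows "interior S = box l r"
  using interior_mono[OF assms(2)] interior_maximal[OF assms(1) open_box] by (simp add: interior_cbox)

lemma measure_lborel_box_cart:
  fixes l r :: "real ^ 'm"
  assumes "\<And>j. l $ j \<le> r $ j"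
  shows "measure lborel (box l r) = (\<Prod>j\<in>UNIV. r $ j - l $ j)"
proof -
  have "measure lborel (box l r) = measure lborel (cbox l r)"
    by (simp add: measure_lborel_box_eq measure_lborel_cbox_eq)
  also have "\<dots> = (\<Prod>j\<in>UNIV. r $ j - l $ j)"
    using assms by (intro content_cbox_cart) (simp add: interval_ne_empty_cart)
  finally show ?thesis .
qed

section \<open>Dyadic upper sums\<close>

lemma mem_dyadic_cube_iff: "x \<in> dyadic_cube k n \<longleftrightarrow> (\<forall>j. n $ j = \<lfloor>2 ^ k * x $ j\<rfloor>)"
proof -
  have "(of_int (n $ j) / 2 ^ k \<le> x $ j \<and> x $ j < (of_int (n $ j) + 1) / 2 ^ k) \<longleftrightarrow>
      n $ j = \<lfloor>2 ^ k * x $ j\<rfloor>" for j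
    by (auto simp: eq_commute[of "n $ j"] floor_eq_iff field_simps)
  then show ?thesis unfolding dyadic_cube_def by blast
qed

lemma dyadic_cube_corner_mem: "(\<chi> j. of_int (n $ j) / 2 ^ k) \<in> dyadic_cube k n"
  by (simp add: mem_dyadic_cube_iff)

lemma inj_dyadic_cube: "inj (dyadic_cube k)"
proof (rule injI)
  fix n n' :: "int ^ 'm" assume "dyadic_cube k n = dyadic_cube k n'"
  then have "(\<chi> j. of_int (n $ j) / 2 ^ k) \<in> dyadic_cube k n'"
    using dyadic_cube_corner_mem by blast
  then show "n = n'" by (simp add: mem_dyadic_cube_iff vec_eq_iff)
qed

lemma disjoint_dyadic_cube: "disjoint_family_on (dyadic_cube k) A"
  unfolding disjoint_family_on_def
proof (intro ballI impI equals0I)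
  fix n n' :: "int ^ 'a" and x assume "n \<noteq> n'" "x \<in> dyadic_cube k n \<inter> dyadic_cube k n'"
  then show False by (simp add: mem_dyadic_cube_iff vec_eq_iff)
qed

lemma dyadic_cube_between_boxes:
  "box (\<chi> j. of_int (n $ j) / 2 ^ k) (\<chi> j. (of_int (n $ j) + 1) / 2 ^ k) \<subseteq> dyadic_cube k n"
  "dyadic_cube k n \<subseteq> cbox (\<chi> j. of_int (n $ j) / 2 ^ k) (\<chi> j. (of_int (n $ j) + 1) / 2 ^ k)"
  by (auto simp: dyadic_cube_def mem_box_cart less_imp_le)

lemma interior_dyadic_cube:
  "interior (dyadic_cube k n) = box (\<chi> j. of_int (n $ j) / 2 ^ k) (\<chi> j. (of_int (n $ j) + 1) / 2 ^ k)"
  by (intro interior_between_boxes dyadic_cube_between_boxes)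

lemma measure_interior_dyadic_cube:
  "measure lborel (interior (dyadic_cube k (n :: int ^ 'm))) = 1 / 2 ^ (k * CARD('m))"
proof -
  have "measure lborel (interior (dyadic_cube k n)) =
      (\<Prod>j\<in>(UNIV :: 'm set). (of_int (n $ j) + 1) / 2 ^ k - of_int (n $ j) / 2 ^ k)"
    unfolding interior_dyadic_cube
    by (subst measure_lborel_box_cart) (auto simp: divide_right_mono)
  also have "\<dots> = (\<Prod>j\<in>(UNIV :: 'm set). 1 / 2 ^ k)"
    by (intro prod.cong refl) (simp add: add_divide_distrib)
  also have "\<dots> = 1 / 2 ^ (k * CARD('m))"
    by (simp add: power_mult power_one_over)
  finally show ?thesis .
qed

definition dyadic_indices :: "nat \<Rightarrow> (real ^ 'm) set \<Rightarrow> (int ^ 'm) set" where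
  "dyadic_indices k A = {n. dyadic_cube k n \<inter> A \<noteq> {}}"

lemma finite_dyadic_indices: "finite (dyadic_indices k (cbox a b))"
proof -
  let ?F = "PiE UNIV (\<lambda>j. {\<lfloor>2 ^ k * a $ j\<rfloor>..\<lfloor>2 ^ k * b $ j\<rfloor>})"
  have "dyadic_indices k (cbox a b) \<subseteq> vec_lambda ` ?F"
  proof
    fix n assume "n \<in> dyadic_indices k (cbox a b)"
    then have "vec_nth n \<in> ?F"
      by (auto simp: dyadic_indices_def mem_dyadic_cube_iff mem_box_cart intro!: floor_mono)
    then have "vec_lambda (vec_nth n) \<in> vec_lambda ` ?F" by (rule imageI)
    then show "n \<in> vec_lambda ` ?F" by simp
  qed
  then show ?thesis by (rule finite_subset) (intro finite_imageI finite_PiE; simp)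
qed

text \<open>
  Cubes that miss the rectangle have supremum \<open>0\<close>, which reduces the infinite sum to a finite
  one; the remaining factor \<open>1 / 2 ^ (k * m)\<close> is the volume of each cube.
\<close>
lemma dyadic_upper_eq_tile_sum:
  fixes f :: "real ^ 'm \<Rightarrow> real"
  assumes 0: "\<And>x. x \<notin> cbox a b \<Longrightarrow> f x = 0"
  shows "dyadic_upper k f = tile_sum f (dyadic_indices k (cbox a b)) (dyadic_cube k)"
proof -
  let ?I = "dyadic_indices k (cbox a b)"
  have "(\<Sum>\<^sub>\<infinity>I\<in>dyadic_cubes k. SUP p\<in>I. f p) = (\<Sum>\<^sub>\<infinity>n. SUP p\<in>dyadic_cube k n. f p)"
    unfolding dyadic_cubes_def by (subst infsum_reindex[OF inj_dyadic_cube]) (simp add: o_def)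
  also have "\<dots> = (\<Sum>\<^sub>\<infinity>n\<in>?I. SUP p\<in>dyadic_cube k n. f p)"
  proof (rule infsum_cong_neutral)
    fix n :: "int ^ 'm" assume "n \<in> UNIV - ?I"
    then have "(SUP p\<in>dyadic_cube k n. f p) = (SUP p\<in>dyadic_cube k n. 0)"
      using 0 by (intro SUP_cong) (auto simp: dyadic_indices_def)
    then show "(SUP p\<in>dyadic_cube k n. f p) = 0"
      using dyadic_cube_corner_mem[of n k] by (subst (asm) cSUP_const) auto
  qed auto
  also have "\<dots> = (\<Sum>n\<in>?I. SUP p\<in>dyadic_cube k n. f p)"
    by (rule infsum_finite) (rule finite_dyadic_indices)
  finally show ?thesis
    by (simp add: dyadic_upper_def tile_sum_def measure_interior_dyadic_cube sum_distrib_left mult.commute)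
qed

text \<open>
  A point on no dyadic hyperplane is interior to its cube. If that cube misses the rectangle,
  \<open>f\<close> vanishes near the point, and so does the envelope.
\<close>
lemma tiling_dyadic:
  fixes f :: "real ^ 'm \<Rightarrow> real"
  assumes f: "bounded (range f)" and 0: "\<And>x. x \<notin> cbox a b \<Longrightarrow> f x = 0"
  shows "tiling f (dyadic_indices k (cbox a b)) (dyadic_cube k)"
  unfolding tiling_def
proof (intro conjI ballI)
  show "disjoint_family_on (\<lambda>n. interior (dyadic_cube k n)) (dyadic_indices k (cbox a b))"
    using disjoint_dyadic_cube interior_subset unfolding disjoint_family_on_def by blast
  have "AE x in lborel. \<forall>j (i::int). (x :: real ^ 'm) $ j \<noteq> of_int i / 2 ^ k"
    by (rule AE_lborel_avoid_hyperplanes)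
  then show "AE x in lborel. x \<notin> (\<Union>n\<in>dyadic_indices k (cbox a b). interior (dyadic_cube k n)) \<longrightarrow>
      upper_envelope f x = 0"
  proof eventually_elim
    case (elim x)
    define n where "n = (\<chi> j. \<lfloor>2 ^ k * x $ j\<rfloor>)"
    have "x \<in> dyadic_cube k n" by (simp add: mem_dyadic_cube_iff n_def)
    then have "of_int (n $ j) / 2 ^ k \<le> x $ j \<and> x $ j < (of_int (n $ j) + 1) / 2 ^ k" for j
      by (simp add: dyadic_cube_def)
    then have "of_int (n $ j) / 2 ^ k < x $ j \<and> x $ j < (of_int (n $ j) + 1) / 2 ^ k" for j
      using elim by (metis order.not_eq_order_implies_strict)
    then have x: "x \<in> interior (dyadic_cube k n)"
      by (simp add: interior_dyadic_cube mem_box_cart)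
    show ?case
    proof
      assume "x \<notin> (\<Union>n\<in>dyadic_indices k (cbox a b). interior (dyadic_cube k n))"
      with x have "dyadic_cube k n \<inter> cbox a b = {}" by (auto simp: dyadic_indices_def)
      then show "upper_envelope f x = 0"
        using 0 by (intro upper_envelope_eq_0[OF f x]) auto
    qed
  qed
qed (simp_all add: finite_dyadic_indices interior_dyadic_cube)

lemma dyadic_upper_tendsto:
  fixes f :: "real ^ 'm \<Rightarrow> real"
  assumes f: "bounded (range f)" and 0: "\<And>x. x \<notin> cbox a b \<Longrightarrow> f x = 0"
  shows "(\<lambda>k. dyadic_upper k f) \<longlonglongrightarrow> (\<integral>x. upper_envelope f x \<partial>lborel)"
proof -
  have tiles: "dyadic_upper k f = tile_sum f (dyadic_indices k (cbox a b)) (dyadic_cube k)" for k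
    using 0 by (rule dyadic_upper_eq_tile_sum)
  have near: "\<bar>x $ j - y $ j\<bar> \<le> (1 / 2) ^ k" if "x \<in> dyadic_cube k n" "y \<in> dyadic_cube k n"
    for k n j and x y :: "real ^ 'm"
  proof -
    have "real_of_int (n $ j) / 2 ^ k \<le> x $ j" "x $ j < real_of_int (n $ j) / 2 ^ k + (1 / 2) ^ k"
       "real_of_int (n $ j) / 2 ^ k \<le> y $ j" "y $ j < real_of_int (n $ j) / 2 ^ k + (1 / 2) ^ k"
      using that by (auto simp: dyadic_cube_def add_divide_distrib power_one_over)
    then show ?thesis by linarith
  qed
  \<comment> \<open>Cubes that meet the rectangle have sides at most 1, so widening it by 1 contains them
    all; this is the common box required for domination.\<close>
  have sub: "dyadic_cube k n \<subseteq> cbox (\<chi> j. a $ j - 1) (\<chi> j. b $ j + 1)"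
    if "n \<in> dyadic_indices k (cbox a b)" for k n
  proof
    fix x assume x: "x \<in> dyadic_cube k n"
    obtain y where y: "y \<in> dyadic_cube k n" "y \<in> cbox a b"
      using \<open>n \<in> _\<close> by (auto simp: dyadic_indices_def)
    have "\<bar>x $ j - y $ j\<bar> \<le> 1" for j
      using near[OF x y(1), of j] power_le_one[of "1/2::real" k] by linarith
    moreover have "a $ j \<le> y $ j" "y $ j \<le> b $ j" for j
      using y(2) by (auto simp: mem_box_cart)
    ultimately have "a $ j - 1 \<le> x $ j \<and> x $ j \<le> b $ j + 1" for j
      by (smt (verit))
    then show "x \<in> cbox (\<chi> j. a $ j - 1) (\<chi> j. b $ j + 1)"
      by (simp add: mem_box_cart)
  qed
  show ?thesis
    unfolding tiles
  proof (rule tile_sum_tendsto)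
    show "(\<lambda>k. \<Sum>j\<in>(UNIV :: 'm set). (1 / 2) ^ k :: real) \<longlonglongrightarrow> 0"
      by (intro tendsto_null_sum LIMSEQ_power_zero) simp
    show "dist x y \<le> (\<Sum>j\<in>(UNIV :: 'm set). (1 / 2) ^ k)"
      if "x \<in> dyadic_cube k n" "y \<in> dyadic_cube k n" for k n and x y :: "real ^ 'm"
      by (rule dist_le_sum_vec) (rule near[OF that])
    show "tiling f (dyadic_indices k (cbox a b)) (dyadic_cube k)" for k
      using f 0 by (rule tiling_dyadic)
  qed (use f 0 sub in auto)
qed

section \<open>Classical upper sums\<close>

lemma partition_mono:
  assumes P: "(N, t) \<in> partitions a b" and "i \<le> i'" "i' \<le> N j"
  shows "t j i \<le> t j i'"
  using assms(2,3)
proof (induction i' rule: dec_induct)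
  case (step n)
  then have "t j n \<le> t j (Suc n)" using P by (auto simp: partitions_def)
  with step show ?case by simp
qed simp

lemma partition_bounds:
  assumes P: "(N, t) \<in> partitions a b" and "i \<le> N j"
  shows "a $ j \<le> t j i" "t j i \<le> b $ j"
  using partition_mono[OF P, of 0 i j] partition_mono[OF P, of i "N j" j] assms
  by (auto simp: partitions_def)

lemma subrect_step:
  assumes P: "P \<in> partitions a b" and i: "i \<in> subrect_indices P"
  shows "snd P j (i j - 1) \<le> snd P j (i j)"
  using partition_mono[of "fst P" "snd P" a b "i j - 1" "i j" j] assms
  by (auto simp: subrect_indices_def)

lemma subrect_subset:
  assumes P: "P \<in> partitions a b" and i: "i \<in> subrect_indices P"
  shows "subrect P i \<subseteq> cbox a b"
proof -
  have "a $ j \<le> snd P j (i j - 1)" "snd P j (i j) \<le> b $ j" for j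
    using partition_bounds[of "fst P" "snd P" a b "i j - 1" j]
      partition_bounds[of "fst P" "snd P" a b "i j" j] P i
    by (auto simp: subrect_indices_def intro: diff_le_self[THEN order_trans])
  then show ?thesis
    unfolding subrect_def by (intro subset_interval_imp_cart) simp
qed

lemma finite_subrect_indices: "finite (subrect_indices (P :: ('m::finite) partition))"
proof -
  have "subrect_indices P \<subseteq> PiE UNIV (\<lambda>j. {1..fst P j})"
    by (auto simp: subrect_indices_def)
  then show ?thesis by (rule finite_subset) (intro finite_PiE; simp)
qed

lemma interior_subrect:
  "interior (subrect P i) = box (\<chi> j. snd P j (i j - 1)) (\<chi> j. snd P j (i j))"
  by (simp add: subrect_def interior_cbox)

lemma upper_sum_eq_tile_sum:
  assumes "P \<in> partitions a b"
  shows "upper_sum f P = tile_sum f (subrect_indices P) (subrect P)"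
  unfolding upper_sum_def tile_sum_def interior_subrect subrect_volume_def
  by (intro sum.cong refl, subst measure_lborel_box_cart) (use subrect_step[OF assms] in auto)

text \<open>
  A point of the rectangle on none of the hyperplanes \<open>x $ j = t j i\<close> lies, in each
  direction, strictly between the first partition point above it and its predecessor. If
  the rectangle is degenerate, all of it lies on these hyperplanes.
\<close>
lemma tiling_subrect:
  fixes f :: "real ^ 'm \<Rightarrow> real"
  assumes f: "bounded (range f)" and 0: "\<And>x. x \<notin> cbox a b \<Longrightarrow> f x = 0"
    and P: "P \<in> partitions a b"
  shows "tiling f (subrect_indices P) (subrect P)"
  unfolding tiling_def
proof (intro conjI ballI)
  obtain N t where Nt: "P = (N, t)" by (cases P)
  show "disjoint_family_on (\<lambda>i. interior (subrect P i)) (subrect_indices P)"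
    unfolding disjoint_family_on_def
  proof (intro ballI impI)
    have *: "interior (subrect P i) \<inter> interior (subrect P i') = {}"
      if i: "i \<in> subrect_indices P" "i' \<in> subrect_indices P" "i j < i' j" for i i' j
    proof -
      have "t j (i j) \<le> t j (i' j - 1)"
        by (rule partition_mono[OF P[unfolded Nt]]) (use i in \<open>auto simp: subrect_indices_def Nt intro: diff_le_self[THEN order_trans]\<close>)
      then show ?thesis
        unfolding interior_subrect Nt by (auto simp: mem_box_cart) (meson less_le_not_le less_trans le_less_trans)
    qed
    fix i i' assume i: "i \<in> subrect_indices P" "i' \<in> subrect_indices P" "i \<noteq> i'"
    then obtain j where "i j < i' j \<or> i' j < i j" by (metis ext linorder_neqE_nat)
    then show "interior (subrect P i) \<inter> interior (subrect P i') = {}"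
      using *[OF i(1,2)] *[OF i(2,1)] by blast
  qed
  have "AE x in lborel. \<forall>j i. (x :: real ^ 'm) $ j \<noteq> t j i"
    by (rule AE_lborel_avoid_hyperplanes)
  then show "AE x in lborel. x \<notin> (\<Union>i\<in>subrect_indices P. interior (subrect P i)) \<longrightarrow>
      upper_envelope f x = 0"
  proof eventually_elim
    case (elim x)
    show ?case
    proof (cases "x \<in> cbox a b")
      case True
      \<comment> \<open>Taking the first point above \<open>x $ j\<close> also skips the empty intervals between
        coinciding partition points.\<close>
      define i where "i j = (LEAST i. x $ j \<le> t j i)" for j
      have N: "x $ j \<le> t j (N j)" for j
        using True P by (auto simp: Nt partitions_def mem_box_cart)
      have up: "x $ j < t j (i j)" for j
        using LeastI[of "\<lambda>i. x $ j \<le> t j i", OF N] elim by (simp add: i_def less_le)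
      have i0: "i j \<noteq> 0" for j
      proof
        assume "i j = 0"
        then have "x $ j < a $ j" using up[of j] P by (simp add: Nt partitions_def)
        then show False using True by (simp add: mem_box_cart not_le[symmetric])
      qed
      have lo: "t j (i j - 1) < x $ j" for j
        using not_less_Least[of "i j - 1" "\<lambda>i. x $ j \<le> t j i"] i0[of j] by (simp add: i_def)
      have "i \<in> subrect_indices P"
        using i0 Least_le[of "\<lambda>i. x $ _ \<le> t _ i", OF N] by (auto simp: subrect_indices_def Nt i_def Suc_le_eq)
      moreover have "x \<in> interior (subrect P i)"
        using lo up by (simp add: interior_subrect Nt mem_box_cart)
      ultimately show ?thesis by blast
    next
      case False
      then show ?thesis
        using upper_envelope_eq_0_outside[OF f closed_cbox 0] by blast
    qed
  qed
qed (simp_all add: finite_subrect_indices interior_subrect)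

definition uniform_partition :: "real ^ 'm \<Rightarrow> real ^ 'm \<Rightarrow> nat \<Rightarrow> 'm partition" where
  "uniform_partition a b n = (\<lambda>j. Suc n, \<lambda>j i. a $ j + real i * ((b $ j - a $ j) / Suc n))"

lemma uniform_partition_mem:
  assumes "\<And>j. a $ j \<le> b $ j"
  shows "uniform_partition a b n \<in> partitions a b"
  using assms
  by (auto simp: uniform_partition_def partitions_def intro!: divide_right_mono mult_right_mono)

lemma upper_sum_uniform_tendsto:
  fixes f :: "real ^ 'm \<Rightarrow> real"
  assumes f: "bounded (range f)" and 0: "\<And>x. x \<notin> cbox a b \<Longrightarrow> f x = 0"
    and ab: "\<And>j. a $ j \<le> b $ j"
  shows "(\<lambda>n. upper_sum f (uniform_partition a b n)) \<longlonglongrightarrow> (\<integral>x. upper_envelope f x \<partial>lborel)"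
  unfolding upper_sum_eq_tile_sum[OF uniform_partition_mem[OF ab]]
proof (rule tile_sum_tendsto)
  show "tiling f (subrect_indices (uniform_partition a b n)) (subrect (uniform_partition a b n))" for n
    using f 0 uniform_partition_mem[OF ab] by (rule tiling_subrect)
  show "subrect (uniform_partition a b n) i \<subseteq> cbox a b"
    if "i \<in> subrect_indices (uniform_partition a b n)" for n i
    using uniform_partition_mem[OF ab] that by (rule subrect_subset)
  show "(\<lambda>n. \<Sum>j\<in>UNIV. (b $ j - a $ j) / Suc n) \<longlonglongrightarrow> 0"
    by (intro tendsto_null_sum LIMSEQ_Suc[OF lim_const_over_n])
  show "dist x y \<le> (\<Sum>j\<in>UNIV. (b $ j - a $ j) / Suc n)"
    if i: "i \<in> subrect_indices (uniform_partition a b n)" 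
      and xy: "x \<in> subrect (uniform_partition a b n) i" "y \<in> subrect (uniform_partition a b n) i" for n i x y
  proof (rule dist_le_sum_vec)
    fix j
    define h where "h = (b $ j - a $ j) / Suc n"
    have "i j \<ge> 1" using i by (simp add: subrect_indices_def)
    then have "real (i j) * h = real (i j - 1) * h + h" by (simp add: of_nat_diff algebra_simps)
    moreover have "a $ j + real (i j - 1) * h \<le> x $ j" "x $ j \<le> a $ j + real (i j) * h"
      "a $ j + real (i j - 1) * h \<le> y $ j" "y $ j \<le> a $ j + real (i j) * h"
      using xy by (simp_all add: subrect_def uniform_partition_def mem_box_cart h_def)
    ultimately have "\<bar>x $ j - y $ j\<bar> \<le> h" by linarith
    then show "\<bar>x $ j - y $ j\<bar> \<le> (b $ j - a $ j) / Suc n" by (simp add: h_def)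
  qed
qed (use f 0 in auto)

text \<open>
  No partition has an upper sum below \<open>\<integral>f*\<close>, and the uniform partitions approach this value.
\<close>
lemma INF_upper_sum:
  fixes f :: "real ^ 'm \<Rightarrow> real"
  assumes f: "bounded (range f)" and 0: "\<And>x. x \<notin> cbox a b \<Longrightarrow> f x = 0"
    and ab: "\<And>j. a $ j \<le> b $ j"
  shows "(INF P\<in>partitions a b. upper_sum f P) = (\<integral>x. upper_envelope f x \<partial>lborel)"
proof (rule antisym)
  have ge: "(\<integral>x. upper_envelope f x \<partial>lborel) \<le> upper_sum f P" if P: "P \<in> partitions a b" for P
    unfolding upper_sum_eq_tile_sum[OF P]
    using f 0 tiling_subrect[OF f 0 P] by (rule integral_upper_envelope_le_tile_sum)
  show "(\<integral>x. upper_envelope f x \<partial>lborel) \<le> (INF P\<in>partitions a b. upper_sum f P)"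
    using uniform_partition_mem[OF ab] ge by (intro cINF_greatest) auto
  have "(INF P\<in>partitions a b. upper_sum f P) \<le> upper_sum f (uniform_partition a b n)" for n
    using ge by (intro cINF_lower bdd_belowI2 uniform_partition_mem ab)
  then show "(INF P\<in>partitions a b. upper_sum f P) \<le> (\<integral>x. upper_envelope f x \<partial>lborel)"
    using upper_sum_uniform_tendsto[OF f 0 ab] by (intro LIMSEQ_le_const) auto
qed

section \<open>Lower sums and the equivalence\<close>

text \<open>
  The infimum on the reals is defined by reflection, so this also holds for the default values
  of unbounded or empty families. Through it lower sums reduce to upper sums.
\<close>
lemma INF_eq_uminus_SUP_uminus:
  fixes f :: "'a \<Rightarrow> real"
  shows "(INF x\<in>S. f x) = - (SUP x\<in>S. - f x)"
  by (simp add: Inf_real_def image_image)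

lemma dyadic_lower_eq: "dyadic_lower k f = - dyadic_upper k (\<lambda>x. - f x)"
  unfolding dyadic_lower_def dyadic_upper_def
  by (subst INF_eq_uminus_SUP_uminus) (simp add: infsum_uminus)

lemma lower_sum_eq: "lower_sum f P = - upper_sum (\<lambda>x. - f x) P"
  unfolding lower_sum_def upper_sum_def
  by (subst INF_eq_uminus_SUP_uminus) (simp add: sum_negf)

lemma SUP_lower_sum_eq:
  "(SUP P\<in>A. lower_sum f P) = - (INF P\<in>A. upper_sum (\<lambda>x. - f x) P)"
  by (simp add: INF_eq_uminus_SUP_uminus lower_sum_eq)

text \<open>
  This passes from \<open>\<phi>\<close>, whose values outside the rectangle are arbitrary, to its extension
  by zero, to which the envelope refers.
\<close>
lemma upper_sum_cong:
  assumes "P \<in> partitions a b" "\<And>x. x \<in> cbox a b \<Longrightarrow> f x = g x"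
  shows "upper_sum f P = upper_sum g P"
  unfolding upper_sum_def
  by (intro sum.cong refl arg_cong2[where f = "(*)"] SUP_cong) (use assms subrect_subset in blast)+

text \<open>
  With \<open>U\<close> the integral of the envelope of \<open>f\<close> and \<open>-L\<close> that of the envelope of \<open>-f\<close>, both
  integrability conditions reduce to \<open>L = U\<close>, and both integrals to this value.
\<close>
lemma classical_integral_eq_dyadic:
  fixes f \<phi> :: "real ^ 'm \<Rightarrow> real"
  assumes f: "bounded (range f)" and 0: "\<And>x. x \<notin> cbox a b \<Longrightarrow> f x = 0"
    and ab: "\<And>j. a $ j \<le> b $ j" and eq: "\<And>x. x \<in> cbox a b \<Longrightarrow> \<phi> x = f x"
  shows "classically_integrable a b \<phi> \<longleftrightarrow> f \<in> RI"
    and "f \<in> RI \<Longrightarrow> classical_integral a b \<phi> = dyadic_integral f"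
proof -
  define U where "U = (\<integral>x. upper_envelope f x \<partial>lborel)"
  define L where "L = - (\<integral>x. upper_envelope (\<lambda>x. - f x) x \<partial>lborel)"
  have f': "bounded (range (\<lambda>x. - f x))"
    using f by (auto simp: bounded_iff)
  have dU: "(\<lambda>k. dyadic_upper k f) \<longlonglongrightarrow> U"
    unfolding U_def using f 0 by (rule dyadic_upper_tendsto)
  have dL: "(\<lambda>k. dyadic_lower k f) \<longlonglongrightarrow> L"
    unfolding L_def dyadic_lower_eq
    by (intro tendsto_minus dyadic_upper_tendsto[OF f']) (use 0 in simp)
  have cU: "(INF P\<in>partitions a b. upper_sum \<phi> P) = U"
  proof -
    have "(INF P\<in>partitions a b. upper_sum \<phi> P) = (INF P\<in>partitions a b. upper_sum f P)"
      by (intro INF_cong refl upper_sum_cong) (use eq in auto)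
    also have "\<dots> = U" unfolding U_def using f 0 ab by (rule INF_upper_sum)
    finally show ?thesis .
  qed
  have "(INF P\<in>partitions a b. upper_sum (\<lambda>x. - \<phi> x) P) = (INF P\<in>partitions a b. upper_sum (\<lambda>x. - f x) P)"
    by (intro INF_cong refl upper_sum_cong) (use eq in auto)
  also have "\<dots> = - L"
    unfolding L_def minus_minus by (rule INF_upper_sum[OF f' _ ab]) (use 0 in simp)
  finally have cL: "(SUP P\<in>partitions a b. lower_sum \<phi> P) = L"
    by (simp add: SUP_lower_sum_eq)
  have "\<phi> ` cbox a b \<subseteq> range f" using eq by auto
  then have "bounded (\<phi> ` cbox a b)" using f bounded_subset by blast
  then have ci: "classically_integrable a b \<phi> \<longleftrightarrow> L = U"
    by (simp add: classically_integrable_def cU cL)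
  have "f \<in> BB"
    unfolding BB_def using f 0 bounded_cbox by blast
  then have ri: "f \<in> RI \<longleftrightarrow> L = U"
    unfolding RI_def using dU dL by (auto dest: LIMSEQ_unique)
  show "classically_integrable a b \<phi> \<longleftrightarrow> f \<in> RI" using ci ri by simp
  show "classical_integral a b \<phi> = dyadic_integral f" if "f \<in> RI"
    using that ri cL limI[OF dU] by (simp add: classical_integral_def dyadic_integral_def)
qed


theorem mainTheorem2:
  shows "(\<forall>(f :: real ^ 'm \<Rightarrow> real) (a :: real ^ 'm) (b :: real ^ 'm).
            f \<in> RI \<and> (\<forall>j. a $ j \<le> b $ j) \<and> (\<forall>x. x \<notin> cbox a b \<longrightarrow> f x = 0) \<longrightarrow>
            classically_integrable a b (restrict f (cbox a b)) \<and>
            classical_integral a b (restrict f (cbox a b)) = dyadic_integral f) \<and>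
         (\<forall>(\<phi> :: real ^ 'm \<Rightarrow> real) (a :: real ^ 'm) (b :: real ^ 'm).
            (\<forall>j. a $ j \<le> b $ j) \<and> classically_integrable a b \<phi> \<longrightarrow>
            (\<lambda>x. if x \<in> cbox a b then \<phi> x else 0) \<in> RI \<and>
            dyadic_integral (\<lambda>x. if x \<in> cbox a b then \<phi> x else 0) = classical_integral a b \<phi>)"
proof (intro conjI allI impI; elim conjE)
  fix f :: "real ^ 'm \<Rightarrow> real" and a b :: "real ^ 'm"
  assume f: "f \<in> RI" and ab: "\<forall>j. a $ j \<le> b $ j" and 0: "\<forall>x. x \<notin> cbox a b \<longrightarrow> f x = 0"
  have "bounded (range f)" using f by (simp add: RI_def BB_def)
  note * = classical_integral_eq_dyadic[OF this, of a b "restrict f (cbox a b)"]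
  show "classically_integrable a b (restrict f (cbox a b))"
    using * f ab 0 by auto
  show "classical_integral a b (restrict f (cbox a b)) = dyadic_integral f"
    using * f ab 0 by auto
next
  fix \<phi> :: "real ^ 'm \<Rightarrow> real" and a b :: "real ^ 'm"
  assume ab: "\<forall>j. a $ j \<le> b $ j" and \<phi>: "classically_integrable a b \<phi>"
  let ?f = "\<lambda>x. if x \<in> cbox a b then \<phi> x else 0"
  have "bounded (insert 0 (\<phi> ` cbox a b))"
    using \<phi> by (simp add: classically_integrable_def)
  then have f: "bounded (range ?f)" by (rule bounded_subset) auto
  note * = classical_integral_eq_dyadic[OF f, of a b \<phi>]
  show RI: "?f \<in> RI" using * \<phi> ab by auto
  show "dyadic_integral ?f = classical_integral a b \<phi>" using *(2)[OF _ _ _ RI] ab by auto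
qed

end
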